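(* Let $k\geq 3$ be odd, and let $G_k$ be the graph with vertex set $\{u,w,v_0,v_1,\ldots,v_{3k-1}\}$ and edge set $\{v_0v_1,v_1v_2,\ldots,v_{3k-2}v_{3k-1},v_{3k-1}v_0\}\cup\{uv_i : i\equiv 1 \text{ or } 2 \pmod 3\}\cup\{wv_i : i\equiv 0 \text{ or } 1 \pmod 3\}$ (indices $i\in\{0,\ldots,3k-1\}$). Then $G_k$ is uniquely 3-colorable.
   Context: A graph $G$ is uniquely $k$-colorable if its chromatic number is $k$ and $G$ has only one proper $k$-coloring up to permutation of the colors. *)

theory Defs
  imports "HOL-Combinatorics.Permutations"
begin

record 'a ugraph =
  verts :: "'a set"
  edges :: "'a set set"

definition finite_simple_graph :: "'a ugraph \<Rightarrow> bool" where
  "finite_simple_graph G \<longleftrightarrow>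
     finite (verts G) \<and> (\<forall>e\<in>edges G. e \<subseteq> verts G \<and> card e = 2)"

text \<open>The colors are \<open>0, \<dots>, k - 1\<close>. The values of \<open>c\<close> outside the vertex set are irrelevant.\<close>

definition proper_coloring :: "'a ugraph \<Rightarrow> nat \<Rightarrow> ('a \<Rightarrow> nat) \<Rightarrow> bool" where
  "proper_coloring G k c \<longleftrightarrow>
     c ` verts G \<subseteq> {..<k} \<and> (\<forall>x y. {x, y} \<in> edges G \<longrightarrow> c x \<noteq> c y)"

text \<open>A finite simple graph always has a proper coloring; only for other graphs
  can the \<open>LEAST\<close> below be unspecified.\<close>

definition chromatic_number :: "'a ugraph \<Rightarrow> nat" where
  "chromatic_number G = (LEAST k. \<exists>c. proper_coloring G k c)"

text \<open>Colorings are functions on the whole type, so they are compared on the vertices only.\<close>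

definition same_up_to_permutation ::
    "'a ugraph \<Rightarrow> nat \<Rightarrow> ('a \<Rightarrow> nat) \<Rightarrow> ('a \<Rightarrow> nat) \<Rightarrow> bool" where
  "same_up_to_permutation G k c c' \<longleftrightarrow>
     (\<exists>p. p permutes {..<k} \<and> (\<forall>x\<in>verts G. c' x = p (c x)))"

definition uniquely_colorable :: "nat \<Rightarrow> 'a ugraph \<Rightarrow> bool" where
  "uniquely_colorable k G \<longleftrightarrow>
     chromatic_number G = k \<and>
     (\<exists>c. proper_coloring G k c \<and>
          (\<forall>c'. proper_coloring G k c' \<longrightarrow> same_up_to_permutation G k c c'))"

datatype vertex = U | W | V nat

definition graph_G :: "nat \<Rightarrow> vertex ugraph" where
  "graph_G k = \<lparr>
     verts = {U, W} \<union> {V i | i. i \<le> 3 * k - 1},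
     edges = {{V i, V (i + 1)} | i. i < 3 * k - 1} \<union> {{V (3 * k - 1), V 0}}
       \<union> {{U, V i} | i. i \<le> 3 * k - 1 \<and> (i mod 3 = 1 \<or> i mod 3 = 2)}
       \<union> {{W, V i} | i. i \<le> 3 * k - 1 \<and> (i mod 3 = 0 \<or> i mod 3 = 1)}\<rparr>"

lemma finite_simple_graph_graph_G:
  assumes "k \<ge> 1"
  shows "finite_simple_graph (graph_G k)"
proof -
  have "{V i | i. i \<le> 3 * k - 1} = V ` {..3 * k - 1}"
    by auto
  then have "finite (verts (graph_G k))"
    by (simp add: graph_G_def)
  moreover have "e \<subseteq> verts (graph_G k) \<and> card e = 2" if "e \<in> edges (graph_G k)" for e
    using that assms by (auto simp: graph_G_def card_insert_if)
  ultimately show ?thesis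
    by (simp add: finite_simple_graph_def)
qed

end

theory Submission
  imports Defs
begin

text \<open>If \<open>u\<close> and \<open>w\<close> had the same color, the two other colors would properly color the odd
  cycle, since each cycle vertex is adjacent to \<open>u\<close> or \<open>w\<close>. So \<open>u\<close> and \<open>w\<close> have different colors;
  this forces the third color on the \<open>v\<^sub>i\<close> with \<open>i \<equiv> 1\<close>, hence the color of \<open>w\<close> on
  those with \<open>i \<equiv> 2\<close> and the color of \<open>u\<close> on those with \<open>i \<equiv> 0\<close>.\<close>

text \<open>With only two values available, each step must switch to the other one, so parity
  decides. It is used along the path from \<open>V 0\<close> to \<open>V (3 * k - 1)\<close>: for
  odd \<open>k\<close> its length is even, so both ends agree, which the closing edge
  forbids.\<close>

lemma alternating_two_colors:
  fixes f :: "nat \<Rightarrow> 'a"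
  assumes "\<And>i. i < n \<Longrightarrow> f i \<noteq> f (Suc i)"
    and "\<And>i. i \<le> n \<Longrightarrow> f i = b \<or> f i = d"
  shows "f n = f 0 \<longleftrightarrow> even n"
proof -
  have "i \<le> n \<Longrightarrow> f i = f 0 \<longleftrightarrow> even i" for i
  proof (induction i)
    case (Suc i)
    then have "f i \<noteq> f (Suc i)" "f i = f 0 \<longleftrightarrow> even i"
      using assms(1) by simp_all
    moreover have "f i = b \<or> f i = d" "f (Suc i) = b \<or> f (Suc i) = d" "f 0 = b \<or> f 0 = d"
      using Suc.prems assms(2) by simp_all
    ultimately show ?case
      unfolding even_Suc by metis
  qed simp
  then show ?thesis
    by simp
qed

text \<open>Unordered edges are unfolded once, leaving inequalities between indexed colors.
  Adjacency to \<open>U\<close> and \<open>W\<close> is phrased by the one excluded residue, so each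
  cycle vertex visibly meets at least one of the last two clauses.\<close>

lemma proper_coloring_graph_G_iff:
  "proper_coloring (graph_G k) m c \<longleftrightarrow>
     c U < m \<and> c W < m \<and> (\<forall>i \<le> 3 * k - 1. c (V i) < m) \<and>
     (\<forall>i < 3 * k - 1. c (V i) \<noteq> c (V (Suc i))) \<and> c (V (3 * k - 1)) \<noteq> c (V 0) \<and>
     (\<forall>i \<le> 3 * k - 1. i mod 3 \<noteq> 0 \<longrightarrow> c (V i) \<noteq> c U) \<and>
     (\<forall>i \<le> 3 * k - 1. i mod 3 \<noteq> 2 \<longrightarrow> c (V i) \<noteq> c W)" (is "?L \<longleftrightarrow> ?R")
proof
  assume ?L
  then have range: "\<And>x. x \<in> verts (graph_G k) \<Longrightarrow> c x < m"
    and edge: "\<And>x y. {x, y} \<in> edges (graph_G k) \<Longrightarrow> c x \<noteq> c y"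
    by (auto simp: proper_coloring_def)
  have "c (V i) \<noteq> c U" if "i \<le> 3 * k - 1" "i mod 3 \<noteq> 0" for i
  proof -
    have "i mod 3 = 1 \<or> i mod 3 = 2"
      using that by linarith
    then show ?thesis
      using edge[of U "V i"] that by (simp add: graph_G_def doubleton_eq_iff)
  qed
  moreover have "c (V i) \<noteq> c W" if "i \<le> 3 * k - 1" "i mod 3 \<noteq> 2" for i
  proof -
    have "i mod 3 = 0 \<or> i mod 3 = 1"
      using that by linarith
    then show ?thesis
      using edge[of W "V i"] that by (simp add: graph_G_def doubleton_eq_iff)
  qed
  moreover have "c (V i) \<noteq> c (V (Suc i))" if "i < 3 * k - 1" for i
    using that by (intro edge) (auto simp: graph_G_def)
  moreover have "c (V (3 * k - 1)) \<noteq> c (V 0)"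
    by (intro edge) (simp add: graph_G_def)
  ultimately show ?R
    using range by (simp add: graph_G_def)
next
  assume R: ?R
  have "c x < m" if "x \<in> verts (graph_G k)" for x
    using that R by (auto simp: graph_G_def)
  moreover have "c x \<noteq> c y" if "{x, y} \<in> edges (graph_G k)" for x y
  proof -
    have "(\<exists>i < 3 * k - 1. {x, y} = {V i, V (Suc i)}) \<or> {x, y} = {V (3 * k - 1), V 0} \<or>
        (\<exists>i \<le> 3 * k - 1. i mod 3 \<noteq> 0 \<and> {x, y} = {U, V i}) \<or>
        (\<exists>i \<le> 3 * k - 1. i mod 3 \<noteq> 2 \<and> {x, y} = {W, V i})"
      using that unfolding graph_G_def ugraph.simps Un_iff mem_Collect_eq singleton_iff
      by (elim disjE exE conjE) auto
    then show ?thesis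
      using R unfolding doubleton_eq_iff by (elim disjE exE conjE) (simp_all, metis+)
  qed
  ultimately show ?L
    by (auto simp: proper_coloring_def)
qed

context
  fixes k m :: nat and c :: "vertex \<Rightarrow> nat"
  assumes k: "k \<ge> 1" "odd k"
    and proper: "proper_coloring (graph_G k) m c"
    and m: "m \<le> 3"
begin

lemma coloring_U_neq_W: "c U \<noteq> c W"
proof
  assume eq: "c U = c W"
  note P = proper[unfolded proper_coloring_graph_G_iff]
  obtain b d where bd: "\<And>x. x < 3 \<Longrightarrow> x \<noteq> c U \<Longrightarrow> x = b \<or> x = d"
  proof -
    have "\<exists>b d. \<forall>x < 3. x \<noteq> c U \<longrightarrow> x = b \<or> x = d"
    proof (intro exI allI impI)
      fix x :: nat
      assume "x < 3" "x \<noteq> c U"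
      moreover have "c U < 3"
        using P m by auto
      ultimately show "x = (if c U = 0 then 1 else 0) \<or> x = (if c U = 2 then 1 else 2)"
        by auto
    qed
    then show ?thesis
      using that by blast
  qed
  have "c (V i) = b \<or> c (V i) = d" if "i \<le> 3 * k - 1" for i
  proof (rule bd)
    show "c (V i) < 3"
      using P that m by (meson less_le_trans)
    show "c (V i) \<noteq> c U"
      \<comment> \<open>Residue 0 is adjacent to \<open>W\<close>, whose color is that of
        \<open>U\<close> by \<open>eq\<close>; the other residues are adjacent to \<open>U\<close>
        itself.\<close>
      using P that eq by (cases "i mod 3 = 0") auto
  qed
  then have "c (V (3 * k - 1)) = c (V 0) \<longleftrightarrow> even (3 * k - 1)"
    using P by (intro alternating_two_colors[where f = "\<lambda>i. c (V i)"]) auto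
  then show False
    using P k by simp
qed

text \<open>The bound \<open>m \<le> 3\<close> instead of \<open>m = 3\<close> lets this serve
  twice: three distinct colors below \<open>m\<close> also rule out \<open>m < 3\<close>.\<close>

lemma coloring_distinct:
  "distinct [c U, c (V 1), c W]" "c U < m" "c (V 1) < m" "c W < m"
proof -
  note P = proper[unfolded proper_coloring_graph_G_iff]
  have "1 \<le> 3 * k - 1" "(1::nat) mod 3 \<noteq> 0" "(1::nat) mod 3 \<noteq> 2"
    using k by simp_all
  then have "c (V 1) < m" "c (V 1) \<noteq> c U" "c (V 1) \<noteq> c W"
    using P by blast+
  then show "distinct [c U, c (V 1), c W]" "c U < m" "c (V 1) < m" "c W < m"
    using P coloring_U_neq_W by auto
qed

lemma coloring_V:
  assumes "i \<le> 3 * k - 1"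
  shows "c (V i) = (if i mod 3 = 0 then c U else if i mod 3 = 1 then c (V 1) else c W)"
proof -
  note P = proper[unfolded proper_coloring_graph_G_iff]
  have pigeonhole: "x = z"
    if "x < m" "x \<noteq> a" "x \<noteq> b" "distinct [a, b, z]" "a < m" "b < m" "z < m" for x a b z
    using that m by auto
  have third: "c (V j) = c (V 1)" if "j \<le> 3 * k - 1" "j mod 3 = 1" for j
  proof -
    have "c (V j) < m" "c (V j) \<noteq> c U" "c (V j) \<noteq> c W"
      using P that by auto
    then show ?thesis
      by (rule pigeonhole) (use coloring_distinct in auto)
  qed
  have "i mod 3 < 3"
    by simp
  then consider "i mod 3 = 0" | "i mod 3 = 1" | "i mod 3 = 2"
    by linarith
  then show ?thesis
  proof cases
    case 1
    \<comment> \<open>The last index \<open>3 * k - 1\<close> has residue 2, so a vertex of residue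
      0 always has a path successor, which carries the third color.\<close>
    have "i < 3 * k - 1" "Suc i mod 3 = 1"
      using 1 assms k by presburger+
    then have "c (V i) < m" "c (V i) \<noteq> c W" "c (V i) \<noteq> c (V 1)"
      using P 1 assms third[of "Suc i"] by force+
    then have "c (V i) = c U"
      by (rule pigeonhole) (use coloring_distinct in auto)
    then show ?thesis
      using 1 by simp
  next
    case 2
    then show ?thesis
      using third[OF assms] by simp
  next
    case 3
    \<comment> \<open>For residue 2, the neighbor with the third color is the predecessor.\<close>
    obtain j where j: "i = Suc j"
      using 3 by (cases i) simp_all
    then have "j < 3 * k - 1" "j mod 3 = 1"
      using 3 assms by (simp, presburger)
    then have "c (V i) \<noteq> c (V 1)"
      using P third[of j] j by fastforce
    moreover have "c (V i) < m" "c (V i) \<noteq> c U"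
      using P assms 3 by simp_all
    ultimately have "c (V i) = c W"
      by (intro pigeonhole[of "c (V i)" "c U" "c (V 1)"]) (use coloring_distinct in auto)
    then show ?thesis
      using 3 by simp
  qed
qed

end

text \<open>\<open>U\<close> and \<open>W\<close> each get the color of the one residue class they
  are not adjacent to.\<close>

definition mod3_coloring :: "vertex \<Rightarrow> nat" where
  "mod3_coloring x = (case x of U \<Rightarrow> 0 | W \<Rightarrow> 2 | V i \<Rightarrow> i mod 3)"

lemma proper_mod3_coloring:
  assumes "k \<ge> 1"
  shows "proper_coloring (graph_G k) 3 mod3_coloring"
proof -
  \<comment> \<open>This form exposes the residue of the last index: the closing edge joins residues
    2 and 0.\<close>
  have "3 * k - 1 = 2 + 3 * (k - 1)"
    using assms by simp
  then have "(3 * k - 1) mod 3 = 2"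
    by (simp only: mod_mult_self2) simp
  moreover have "i mod 3 \<noteq> Suc i mod 3" for i :: nat
    by (simp add: mod_Suc)
  ultimately show ?thesis
    by (simp add: proper_coloring_graph_G_iff mod3_coloring_def)
qed

lemma chromatic_number_graph_G:
  assumes "k \<ge> 1" "odd k"
  shows "chromatic_number (graph_G k) = 3"
  unfolding chromatic_number_def
proof (rule Least_equality)
  show "\<exists>c. proper_coloring (graph_G k) 3 c"
    using proper_mod3_coloring assms by blast
next
  fix m
  assume "\<exists>c. proper_coloring (graph_G k) m c"
  then obtain c where c: "proper_coloring (graph_G k) m c" ..
  show "3 \<le> m"
  proof (rule ccontr)
    assume "\<not> 3 \<le> m"
    then show False
      using coloring_distinct[OF assms c] by auto
  qed
qed

lemma same_up_to_permutation_mod3_coloring: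
  assumes k: "k \<ge> 1" "odd k" and c: "proper_coloring (graph_G k) 3 c"
  shows "same_up_to_permutation (graph_G k) 3 mod3_coloring c"
proof -
  note D = coloring_distinct[OF k c order_refl]
  \<comment> \<open>The vertices \<open>U\<close>, \<open>V 1\<close>, \<open>W\<close> represent
    the colors 0, 1, 2 of \<open>mod3_coloring\<close>, so \<open>p\<close> must send these to their
    colors under \<open>c\<close>. The default \<open>x\<close> is what \<open>permutes\<close>
    requires outside \<open>{..<3}\<close>.\<close>
  define p where
    "p x = (if x = 0 then c U else if x = 1 then c (V 1) else if x = 2 then c W else x)" for x
  have less3: "{..<3} = {0, 1, 2 :: nat}"
    by auto
  have "inj_on p {..<3}" "p ` {..<3} \<subseteq> {..<3}"
    using D by (auto simp: p_def less3 inj_on_def)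
  then have "bij_betw p {..<3} {..<3}"
    by (simp add: bij_betw_def endo_inj_surj)
  then have "p permutes {..<3}"
    by (rule bij_imp_permutes) (auto simp: p_def)
  moreover have "c x = p (mod3_coloring x)" if "x \<in> verts (graph_G k)" for x
  proof (cases x)
    case (V i)
    have "i mod 3 < 3"
      by simp
    then have "i mod 3 = 0 \<or> i mod 3 = 1 \<or> i mod 3 = 2"
      by linarith
    moreover have "i \<le> 3 * k - 1"
      using that V by (simp add: graph_G_def)
    note coloring_V[OF k c order_refl this]
    ultimately show ?thesis
      unfolding V p_def mod3_coloring_def vertex.case by presburger
  qed (simp_all add: p_def mod3_coloring_def)
  ultimately show ?thesis
    unfolding same_up_to_permutation_def by blast
qed

theorem theorem3p1:
  fixes k :: nat
  assumes "k \<ge> 3" and "odd k"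
  shows "uniquely_colorable 3 (graph_G k)"
proof -
  have "k \<ge> 1"
    using assms by simp
  then show ?thesis
    unfolding uniquely_colorable_def
    using assms chromatic_number_graph_G proper_mod3_coloring same_up_to_permutation_mod3_coloring
    by blast
qed

end
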